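(* Let $U$ be a solution in the double CRPs frame of the Riemann problem with constant initial state $U_1$ and a single-point heating source $Q>0$ at $x=0$ (all notions are defined in the context). Then there are three different possible structures of $U$, as follows (any listed elementary wave other than the heating discontinuity $H$ may be trivial). (1) Type 1: if $M_4<M_5<1$, then the structure is $S(U_1,U_4)\oplus H(U_4,U_5)\oplus C(U_5,U_7)\oplus S(U_7,U_8)$. (2) Type 2: if $M_4<M_5=1$, then the structure is $S(U_1,U_4)\oplus H(U_4,U_5)\oplus R(U_5,U_6)\oplus C(U_6,U_7)\oplus S(U_7,U_8)$. (3) Type 3: if $M_4>M_5\ge 1$, then the structure is $H(U_1,U_5)\oplus R(U_5,U_6)\oplus C(U_6,U_7)\oplus S(U_7,U_8)$ (so $U_4=U_1$). One of these three cases always holds.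
   Context: Gas. Fix $1<\gamma\le 3$. A state is given by density $\rho>0$, velocity $u$, pressure $p>0$; $p=(\gamma-1)\rho e$ with $e$ the internal energy, total energy $E=\rho e+\frac12\rho u^2$, sound speed $a=\sqrt{\gamma p/\rho}$, Mach number $M=u/a$. Indices on $\rho,u,p,a,M$ match the index of the state. Riemann problem. $\partial_t U+\partial_x F=S$ with $U=(\rho,\rho u,E)^T$, $F=(\rho u,\rho u^2+p,(E+p)u)^T$, $S=(0,0,Q\,\delta(x))^T$, $Q>0$ constant, $\delta$ the Dirac delta, and initial condition $U(x,0)\equiv U_1$, a constant state with $u_1>0$. Double CRPs frame. CRP means the classical Riemann problem for the homogeneous Euler equations ($S=0$), solved by its self-similar entropy solution. A solution in the double CRPs frame is a function $U(x,t)$ such that the states $U_-=U(0-,t)$ and $U_+=U(0+,t)$ on the two sides of the heating point are constant in $t$ and have $u_\pm\neq 0$; in $x<0$, $U$ is the left half of the CRP solution with left state $U_1$ and right state $U_-$ (all its waves having speed $\le 0$); in $x>0$, $U$ is the right half of the CRP solution with left state $U_+$ and right state $U_1$ (all its waves having speed $\ge 0$); and across $x=0$: $\rho_-u_-=\rho_+u_+$, $\rho_-u_-^2+p_-=\rho_+u_+^2+p_+$, $(E_-+p_-)u_-+Q=(E_++p_+)u_+$. The jump at $x=0$ is the heating discontinuity and is on the physical branch: if the upstream flow (the side from which fluid enters the heating point) is subsonic, the downstream flow satisfies $|M|\le1$; if the upstream flow is supersonic, the downstream flow satisfies $|M|\ge1$. Notation. From left to right, the possible waves in $x<0$ are $WL_1,WL_2,WL_3$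 and in $x>0$ are $WR_1,WR_2,WR_3$; index $1$ is a genuinely nonlinear wave (shock or rarefaction) of the field $u-a$, index $2$ a contact discontinuity (field $u$), index $3$ a genuinely nonlinear wave of the field $u+a$. The constant states from left to right are $U_1$ ($WL_1$) $U_2$ ($WL_2$) $U_3$ ($WL_3$) $U_4$ (heating discontinuity at $x=0$) $U_5$ ($WR_1$) $U_6$ ($WR_2$) $U_7$ ($WR_3$) $U_8$, with $U_8=U_1$, $U_4=U_-$, $U_5=U_+$. A wave does not exist (is trivial) if the states on its two sides coincide. $S(\cdot,\cdot)$, $R(\cdot,\cdot)$, $C(\cdot,\cdot)$, $H(\cdot,\cdot)$ mean the two states are connected by a shock, a rarefaction wave, a contact discontinuity, the heating discontinuity, respectively; $\oplus$ lists them from left to right. *)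

theory Defs
  imports "HOL-Analysis.Analysis"
begin

section \<open>Gas states and the Euler equations\<close>

text \<open>A state is stored in primitive variables: density, velocity, pressure.\<close>

type_synonym state = "real \<times> real \<times> real"

definition dens :: "state \<Rightarrow> real" where "dens w = fst w"
definition vel :: "state \<Rightarrow> real" where "vel w = fst (snd w)"
definition pres :: "state \<Rightarrow> real" where "pres w = snd (snd w)"

definition is_state :: "state \<Rightarrow> bool" where
  "is_state w \<longleftrightarrow> dens w > 0 \<and> pres w > 0"

text \<open>From \<open>p = (\<gamma> - 1) \<rho> e\<close>.\<close>

definition internal_energy :: "real \<Rightarrow> state \<Rightarrow> real" where
  "internal_energy \<gamma> w = pres w / ((\<gamma> - 1) * dens w)"

definition total_energy :: "real \<Rightarrow> state \<Rightarrow> real" where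
  "total_energy \<gamma> w = dens w * internal_energy \<gamma> w + 1 / 2 * dens w * (vel w)\<^sup>2"

definition sound_speed :: "real \<Rightarrow> state \<Rightarrow> real" where
  "sound_speed \<gamma> w = sqrt (\<gamma> * pres w / dens w)"

definition mach :: "real \<Rightarrow> state \<Rightarrow> real" where
  "mach \<gamma> w = vel w / sound_speed \<gamma> w"

definition conserved :: "real \<Rightarrow> state \<Rightarrow> real \<times> real \<times> real" where
  "conserved \<gamma> w = (dens w, dens w * vel w, total_energy \<gamma> w)"

definition flux :: "real \<Rightarrow> state \<Rightarrow> real \<times> real \<times> real" where
  "flux \<gamma> w =
    (dens w * vel w,
     dens w * (vel w)\<^sup>2 + pres w,
     (total_energy \<gamma> w + pres w) * vel w)"

definition char_speed :: "real \<Rightarrow> nat \<Rightarrow> state \<Rightarrow> real" where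
  "char_speed \<gamma> k w =
    (if k = 1 then vel w - sound_speed \<gamma> w
     else if k = 3 then vel w + sound_speed \<gamma> w
     else vel w)"

section \<open>Elementary waves\<close>

definition rankine_hugoniot :: "real \<Rightarrow> real \<Rightarrow> state \<Rightarrow> state \<Rightarrow> bool" where
  "rankine_hugoniot \<gamma> s L R \<longleftrightarrow>
    flux \<gamma> R - flux \<gamma> L = s *\<^sub>R (conserved \<gamma> R - conserved \<gamma> L)"

text \<open>The last two conditions are the Lax entropy condition of the \<open>k\<close>-th field; \<open>k\<close> is 1 or 3.\<close>

definition shock :: "real \<Rightarrow> nat \<Rightarrow> real \<Rightarrow> state \<Rightarrow> state \<Rightarrow> bool" where
  "shock \<gamma> k s L R \<longleftrightarrow>
    rankine_hugoniot \<gamma> s L R \<and> char_speed \<gamma> k R < s \<and> s < char_speed \<gamma> k L"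

definition contact :: "real \<Rightarrow> real \<Rightarrow> state \<Rightarrow> state \<Rightarrow> bool" where
  "contact \<gamma> s L R \<longleftrightarrow> rankine_hugoniot \<gamma> s L R \<and> s = vel L \<and> s = vel R \<and> L \<noteq> R"

text \<open>A centred rarefaction wave of the \<open>k\<close>-th field (\<open>k\<close> is 1 or 3), as a function \<open>V\<close> of
  \<open>\<xi> = x / t\<close>. Inside the fan \<open>\<xi>\<close> is the \<open>k\<close>-th characteristic speed, and
  \<open>U(x,t) = V(x/t)\<close> solves the homogeneous Euler equations classically, which for a self-similar
  function means that the \<open>\<xi>\<close>-derivative of the flux is \<open>\<xi>\<close> times that of the conserved
  variables.\<close>

definition rarefaction :: "real \<Rightarrow> nat \<Rightarrow> (real \<Rightarrow> state) \<Rightarrow> state \<Rightarrow> state \<Rightarrow> bool" where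
  "rarefaction \<gamma> k V L R \<longleftrightarrow>
    char_speed \<gamma> k L < char_speed \<gamma> k R \<and>
    V (char_speed \<gamma> k L) = L \<and> V (char_speed \<gamma> k R) = R \<and>
    continuous_on {char_speed \<gamma> k L..char_speed \<gamma> k R} V \<and>
    (\<forall>\<xi>\<in>{char_speed \<gamma> k L..char_speed \<gamma> k R}. is_state (V \<xi>) \<and> char_speed \<gamma> k (V \<xi>) = \<xi>) \<and>
    (\<forall>\<xi>\<in>{char_speed \<gamma> k L<..<char_speed \<gamma> k R}. \<exists>D.
       ((\<lambda>\<eta>. conserved \<gamma> (V \<eta>)) has_vector_derivative D) (at \<xi>) \<and>
       ((\<lambda>\<eta>. flux \<gamma> (V \<eta>)) has_vector_derivative \<xi> *\<^sub>R D) (at \<xi>))"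

definition shock_connected :: "real \<Rightarrow> nat \<Rightarrow> state \<Rightarrow> state \<Rightarrow> bool" where
  "shock_connected \<gamma> k L R \<longleftrightarrow> (\<exists>s. shock \<gamma> k s L R)"

definition rarefaction_connected :: "real \<Rightarrow> nat \<Rightarrow> state \<Rightarrow> state \<Rightarrow> bool" where
  "rarefaction_connected \<gamma> k L R \<longleftrightarrow> (\<exists>V. rarefaction \<gamma> k V L R)"

definition contact_connected :: "real \<Rightarrow> state \<Rightarrow> state \<Rightarrow> bool" where
  "contact_connected \<gamma> L R \<longleftrightarrow> (\<exists>s. contact \<gamma> s L R)"

section \<open>Classical Riemann problem\<close>

text \<open>The wave occupies \<open>\<sigma> \<le> \<xi> \<le> \<tau>\<close>. A trivial wave sits on an arbitrary ray where \<open>V\<close> does not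
  jump, so that its position is no constraint.\<close>

definition nonlinear_wave ::
  "real \<Rightarrow> nat \<Rightarrow> (real \<Rightarrow> state) \<Rightarrow> real \<Rightarrow> real \<Rightarrow> state \<Rightarrow> state \<Rightarrow> bool" where
  "nonlinear_wave \<gamma> k V \<sigma> \<tau> L R \<longleftrightarrow>
    (L = R \<and> \<sigma> = \<tau> \<and> V \<sigma> = L) \<or>
    (shock \<gamma> k \<sigma> L R \<and> \<sigma> = \<tau>) \<or>
    (rarefaction \<gamma> k V L R \<and> \<sigma> = char_speed \<gamma> k L \<and> \<tau> = char_speed \<gamma> k R)"

definition contact_wave ::
  "real \<Rightarrow> (real \<Rightarrow> state) \<Rightarrow> real \<Rightarrow> state \<Rightarrow> state \<Rightarrow> bool" where
  "contact_wave \<gamma> V \<sigma> L R \<longleftrightarrow> (L = R \<and> V \<sigma> = L) \<or> contact \<gamma> \<sigma> L R"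

text \<open>The self-similar entropy solution \<open>U(x,t) = V(x/t)\<close> of the classical Riemann problem with
  left state \<open>A\<close>, right state \<open>D\<close>, and intermediate states \<open>B\<close>, \<open>C\<close>. Values of \<open>V\<close> exactly on a
  jump are irrelevant.\<close>

definition crp_solution ::
  "real \<Rightarrow> (real \<Rightarrow> state) \<Rightarrow> real \<Rightarrow> real \<Rightarrow> real \<Rightarrow> real \<Rightarrow> real \<Rightarrow>
   state \<Rightarrow> state \<Rightarrow> state \<Rightarrow> state \<Rightarrow> bool" where
  "crp_solution \<gamma> V \<sigma>1 \<tau>1 \<sigma>2 \<sigma>3 \<tau>3 A B C D \<longleftrightarrow>
    is_state A \<and> is_state B \<and> is_state C \<and> is_state D \<and>
    \<sigma>1 \<le> \<tau>1 \<and> \<tau>1 \<le> \<sigma>2 \<and> \<sigma>2 \<le> \<sigma>3 \<and> \<sigma>3 \<le> \<tau>3 \<and>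
    (\<forall>\<xi><\<sigma>1. V \<xi> = A) \<and>
    nonlinear_wave \<gamma> 1 V \<sigma>1 \<tau>1 A B \<and>
    (\<forall>\<xi>\<in>{\<tau>1<..<\<sigma>2}. V \<xi> = B) \<and>
    contact_wave \<gamma> V \<sigma>2 B C \<and>
    (\<forall>\<xi>\<in>{\<sigma>2<..<\<sigma>3}. V \<xi> = C) \<and>
    nonlinear_wave \<gamma> 3 V \<sigma>3 \<tau>3 C D \<and>
    (\<forall>\<xi>>\<tau>3. V \<xi> = D)"

section \<open>Heating discontinuity and the double CRPs frame\<close>

definition heating_jump :: "real \<Rightarrow> real \<Rightarrow> state \<Rightarrow> state \<Rightarrow> bool" where
  "heating_jump \<gamma> Q L R \<longleftrightarrow>
    dens L * vel L = dens R * vel R \<and>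
    dens L * (vel L)\<^sup>2 + pres L = dens R * (vel R)\<^sup>2 + pres R \<and>
    (total_energy \<gamma> L + pres L) * vel L + Q = (total_energy \<gamma> R + pres R) * vel R"

text \<open>By conservation of mass both sides of the jump have the same flow direction.\<close>

definition physical_branch :: "real \<Rightarrow> state \<Rightarrow> state \<Rightarrow> bool" where
  "physical_branch \<gamma> L R \<longleftrightarrow>
    (let (up, down) = (if vel L > 0 then (L, R) else (R, L)) in
      (\<bar>mach \<gamma> up\<bar> < 1 \<longrightarrow> \<bar>mach \<gamma> down\<bar> \<le> 1) \<and>
      (\<bar>mach \<gamma> up\<bar> > 1 \<longrightarrow> \<bar>mach \<gamma> down\<bar> \<ge> 1))"

definition heating_discontinuity :: "real \<Rightarrow> real \<Rightarrow> state \<Rightarrow> state \<Rightarrow> bool" where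
  "heating_discontinuity \<gamma> Q L R \<longleftrightarrow> heating_jump \<gamma> Q L R \<and> physical_branch \<gamma> L R"

text \<open>\<open>W 1, \<dots>, W 8\<close> are the constant states of \<open>U\<close> from left to right; \<open>W 1 = W 8\<close> is the initial
  state, and the heating discontinuity lies between \<open>W 4\<close> and \<open>W 5\<close>.\<close>

definition double_CRPs_solution ::
  "real \<Rightarrow> real \<Rightarrow> (nat \<Rightarrow> state) \<Rightarrow> (real \<Rightarrow> real \<Rightarrow> state) \<Rightarrow> bool" where
  "double_CRPs_solution \<gamma> Q W U \<longleftrightarrow>
    W 8 = W 1 \<and>
    (\<forall>x. U x 0 = W 1) \<and>
    (\<forall>t>0. ((\<lambda>x. U x t) \<longlongrightarrow> W 4) (at_left 0) \<and> ((\<lambda>x. U x t) \<longlongrightarrow> W 5) (at_right 0)) \<and>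
    vel (W 4) \<noteq> 0 \<and> vel (W 5) \<noteq> 0 \<and>
    (\<exists>V \<sigma>1 \<tau>1 \<sigma>2 \<sigma>3 \<tau>3.
       crp_solution \<gamma> V \<sigma>1 \<tau>1 \<sigma>2 \<sigma>3 \<tau>3 (W 1) (W 2) (W 3) (W 4) \<and> \<tau>3 \<le> 0 \<and>
       (\<forall>x t. x < 0 \<and> t > 0 \<longrightarrow> U x t = V (x / t))) \<and>
    (\<exists>V \<sigma>1 \<tau>1 \<sigma>2 \<sigma>3 \<tau>3.
       crp_solution \<gamma> V \<sigma>1 \<tau>1 \<sigma>2 \<sigma>3 \<tau>3 (W 5) (W 6) (W 7) (W 8) \<and> 0 \<le> \<sigma>1 \<and>
       (\<forall>x t. x > 0 \<and> t > 0 \<longrightarrow> U x t = V (x / t))) \<and>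
    heating_discontinuity \<gamma> Q (W 4) (W 5)"

end

theory Submission
  imports Defs
begin

text \<open>Each wave imposes an ordering of velocities and pressures on its two sides, and the constraint
  that left waves have nonpositive and right waves nonnegative speed imposes a Mach number bound on
  the state next to the heating point. Comparing the two leaves only the three listed structures.

  At the heating point, mass and momentum balance make the energy flux a quadratic function of the
  pressure, so the quantity \<open>\<gamma> p - \<rho> u\<^sup>2\<close>, positive exactly for subsonic flow, satisfies an identity
  between squares (\<open>heating_jump_gap_squares\<close>). Heating moves the gas strictly towards the sonic
  state: subsonic gas is accelerated and loses pressure, supersonic gas is slowed down and gains
  pressure. Across a shock of either field the velocity decreases from left to right, across a
  rarefaction it increases; the pressure changes in the same direction as the velocity for the
  field \<open>u + a\<close> and in the opposite direction for \<open>u - a\<close>.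

  A backward flow through the heating point would need pressures that contradict these orderings
  (\<open>no_backflow\<close>). With forward flow, a 3-wave or contact of nonpositive speed cannot occur on the
  left, so at most a 1-wave remains there, and only when the flow at the heating point is not
  supersonic; on the right a 1-wave requires outflow that is not subsonic.

  A rarefaction on the left would make the gas arriving at the last 3-wave both faster and of lower
  pressure than the initial state, and so would not fit that wave, across which velocity and
  pressure are ordered alike. A 1-shock on the right is excluded in the same way, with slower gas
  of higher pressure. Finally, a rarefaction as last wave would need both \<open>u\<^sub>6 < u\<^sub>1\<close> and
  \<open>p\<^sub>6 < p\<^sub>1\<close>. This contradicts \<open>p\<^sub>1 - p\<^sub>6 \<le> m (u\<^sub>6 - u\<^sub>1)\<close>, where \<open>m > 0\<close> is the mass flux through the
  heating point. That inequality holds across each of the three links separately: with equality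
  across the heating, for the left shock because its mass flux is at least \<open>m\<close>
  (\<open>shock_1_monotone\<close>), and for the right rarefaction because \<open>\<rho> a\<close> never exceeds \<open>m\<close> in it
  (\<open>downstream_rarefaction_1_bound\<close>).\<close>

section \<open>Sound speed and the sonic gap\<close>

lemma sound_speed_pos:
  assumes "1 < \<gamma>" "is_state w"
  shows "sound_speed \<gamma> w > 0"
  using assms by (simp add: sound_speed_def is_state_def)

lemma dens_sound_speed_squared:
  assumes "1 < \<gamma>" "is_state w"
  shows "dens w * (sound_speed \<gamma> w)\<^sup>2 = \<gamma> * pres w"
  using assms by (simp add: sound_speed_def is_state_def)

lemma char_speed_1: "char_speed \<gamma> 1 w = vel w - sound_speed \<gamma> w"
  and char_speed_3: "char_speed \<gamma> 3 w = vel w + sound_speed \<gamma> w"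
  by (simp_all add: char_speed_def)

text \<open>This is \<open>\<rho> (a\<^sup>2 - u\<^sup>2)\<close>. Written without the sound speed it is, for fixed mass and momentum flux,
  affine in the pressure.\<close>

definition sonic_gap :: "real \<Rightarrow> state \<Rightarrow> real" where
  "sonic_gap \<gamma> w = \<gamma> * pres w - dens w * (vel w)\<^sup>2"

lemma sonic_gap_pos_iff: "sonic_gap \<gamma> w > 0 \<longleftrightarrow> \<bar>vel w\<bar> < sound_speed \<gamma> w"
  and sonic_gap_neg_iff: "sonic_gap \<gamma> w < 0 \<longleftrightarrow> \<bar>vel w\<bar> > sound_speed \<gamma> w"
  if "1 < \<gamma>" "is_state w"
proof -
  define a where "a = sound_speed \<gamma> w"
  have a: "a > 0" and d: "dens w > 0" using sound_speed_pos[OF that] that by (auto simp: a_def is_state_def)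
  have "sonic_gap \<gamma> w = dens w * (a\<^sup>2 - \<bar>vel w\<bar>\<^sup>2)"
    using dens_sound_speed_squared[OF that] by (simp add: sonic_gap_def a_def right_diff_distrib)
  then have "sonic_gap \<gamma> w > 0 \<longleftrightarrow> \<bar>vel w\<bar>\<^sup>2 < a\<^sup>2" "sonic_gap \<gamma> w < 0 \<longleftrightarrow> a\<^sup>2 < \<bar>vel w\<bar>\<^sup>2"
    using d by (simp_all add: zero_less_mult_iff mult_less_0_iff)
  then show "sonic_gap \<gamma> w > 0 \<longleftrightarrow> \<bar>vel w\<bar> < sound_speed \<gamma> w"
    "sonic_gap \<gamma> w < 0 \<longleftrightarrow> \<bar>vel w\<bar> > sound_speed \<gamma> w"
    using a power_mono_iff[of "\<bar>vel w\<bar>" a 2] power_mono_iff[of a "\<bar>vel w\<bar>" 2]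
    unfolding a_def[symmetric] by (simp_all flip: not_le)
qed

lemma abs_mach_less_1_iff:
  assumes "1 < \<gamma>" "is_state w"
  shows "\<bar>mach \<gamma> w\<bar> < 1 \<longleftrightarrow> sonic_gap \<gamma> w > 0"
  using sound_speed_pos[OF assms]
  by (simp add: sonic_gap_pos_iff[OF assms] mach_def)

lemma abs_mach_greater_1_iff:
  assumes "1 < \<gamma>" "is_state w"
  shows "\<bar>mach \<gamma> w\<bar> > 1 \<longleftrightarrow> sonic_gap \<gamma> w < 0"
  using sound_speed_pos[OF assms]
  by (simp add: sonic_gap_neg_iff[OF assms] mach_def)

text \<open>With mass flux \<open>m\<close>, the squared Mach number is \<open>m u / (\<gamma> p)\<close>.\<close>

lemma mach_less_if_faster_and_lower_pressure:
  assumes "1 < \<gamma>" "is_state v" "is_state w"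
    and "dens v * vel v = dens w * vel w" "0 < vel v" "vel v < vel w" "pres w < pres v"
  shows "mach \<gamma> v < mach \<gamma> w"
proof -
  have sq: "(mach \<gamma> x)\<^sup>2 = (dens x * vel x) * vel x / (\<gamma> * pres x)" if "is_state x" for x
    using that assms(1)
    by (simp add: mach_def sound_speed_def is_state_def power_divide power2_eq_square field_simps)
  have pos: "0 < dens v" "0 < pres v" "0 < pres w" "0 < dens v * vel v"
    using assms by (auto simp: is_state_def)
  have "vel v / pres v < vel w / pres w"
    using assms pos by (intro frac_less2) auto
  then have "(dens v * vel v) / \<gamma> * (vel v / pres v) < (dens v * vel v) / \<gamma> * (vel w / pres w)"
    using pos assms(1) by (intro mult_strict_left_mono) auto
  then have "(mach \<gamma> v)\<^sup>2 < (mach \<gamma> w)\<^sup>2"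
    using assms(4) by (simp add: sq[OF assms(2)] sq[OF assms(3)])
  moreover have "0 \<le> mach \<gamma> w"
    using assms sound_speed_pos[OF assms(1,3)] by (simp add: mach_def)
  ultimately show ?thesis by (rule power2_less_imp_less)
qed

section \<open>The heating discontinuity\<close>

lemma heating_jump_vel_sign:
  assumes "heating_jump \<gamma> Q L R" "is_state L" "is_state R"
  shows "vel R > 0 \<longleftrightarrow> vel L > 0" "vel R < 0 \<longleftrightarrow> vel L < 0"
proof -
  have "dens L * vel L = dens R * vel R" "dens L > 0" "dens R > 0"
    using assms by (auto simp: heating_jump_def is_state_def)
  then show "vel R > 0 \<longleftrightarrow> vel L > 0" "vel R < 0 \<longleftrightarrow> vel L < 0"
    by (metis zero_less_mult_pos zero_less_mult_iff less_asym)
       (metis \<open>dens L * vel L = dens R * vel R\<close> \<open>dens L > 0\<close> \<open>dens R > 0\<close> mult_less_0_iff less_asym)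
qed

lemma heating_jump_pressure_velocity:
  assumes "heating_jump \<gamma> Q L R"
  shows "pres L - pres R = dens L * vel L * (vel R - vel L)"
proof -
  have m: "dens L * vel L = dens R * vel R" using assms by (simp add: heating_jump_def)
  have "dens L * (vel L)\<^sup>2 + pres L = dens R * (vel R)\<^sup>2 + pres R"
    using assms by (simp add: heating_jump_def)
  then have "pres L - pres R = (dens R * vel R) * vel R - (dens L * vel L) * vel L"
    by (simp add: power2_eq_square algebra_simps)
  then show ?thesis unfolding m by (simp add: algebra_simps)
qed

lemma heating_jump_gap_difference:
  assumes "heating_jump \<gamma> Q L R"
  shows "sonic_gap \<gamma> L - sonic_gap \<gamma> R = (\<gamma> + 1) * (pres L - pres R)"
  using assms by (simp add: heating_jump_def sonic_gap_def algebra_simps)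

text \<open>For fixed mass flux \<open>m\<close> and momentum flux \<open>P\<close> the energy flux is a quadratic function of the
  pressure, with vertex at the sonic state; completing the square there turns the gap into the
  natural coordinate. Heat therefore always moves the gas towards the sonic state, and a sonic
  inflow cannot be heated.\<close>

lemma heating_jump_gap_squares:
  assumes "1 < \<gamma>" "is_state L" "is_state R" "heating_jump \<gamma> Q L R"
  shows "(sonic_gap \<gamma> L)\<^sup>2 - (sonic_gap \<gamma> R)\<^sup>2 = 2 * (\<gamma>\<^sup>2 - 1) * (dens L * vel L) * Q"
proof -
  define m P where "m = dens L * vel L" and "P = pres L + m * vel L"
  have mR: "m = dens R * vel R" using assms(4) by (simp add: heating_jump_def m_def)
  have P: "pres L = P - m * vel L" "pres R = P - m * vel R"
    using heating_jump_pressure_velocity[OF assms(4)] by (simp_all add: P_def m_def algebra_simps)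
  have g: "sonic_gap \<gamma> L = \<gamma> * P - (\<gamma> + 1) * m * vel L"
    "sonic_gap \<gamma> R = \<gamma> * P - (\<gamma> + 1) * m * vel R"
  proof -
    have "sonic_gap \<gamma> L = \<gamma> * pres L - m * vel L" "sonic_gap \<gamma> R = \<gamma> * pres R - m * vel R"
      using mR by (simp_all add: sonic_gap_def m_def power2_eq_square)
    then show "sonic_gap \<gamma> L = \<gamma> * P - (\<gamma> + 1) * m * vel L"
      "sonic_gap \<gamma> R = \<gamma> * P - (\<gamma> + 1) * m * vel R"
      unfolding P by (simp_all add: algebra_simps)
  qed
  have e: "2 * (\<gamma> - 1) * ((total_energy \<gamma> w + pres w) * vel w) =
      2 * \<gamma> * pres w * vel w + (\<gamma> - 1) * (dens w * vel w) * (vel w)\<^sup>2" if "is_state w" for w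
    using that assms(1)
    by (simp add: total_energy_def internal_energy_def is_state_def power2_eq_square field_simps)
  have eL: "2 * (\<gamma> - 1) * ((total_energy \<gamma> L + pres L) * vel L) =
      2 * \<gamma> * (P - m * vel L) * vel L + (\<gamma> - 1) * m * (vel L)\<^sup>2"
    using e[OF assms(2)] unfolding P(1) m_def[symmetric] by simp
  have eR: "2 * (\<gamma> - 1) * ((total_energy \<gamma> R + pres R) * vel R) =
      2 * \<gamma> * (P - m * vel R) * vel R + (\<gamma> - 1) * m * (vel R)\<^sup>2"
    using e[OF assms(3)] unfolding P(2) mR[symmetric] by simp
  have "(total_energy \<gamma> L + pres L) * vel L + Q = (total_energy \<gamma> R + pres R) * vel R"
    using assms(4) by (simp add: heating_jump_def)
  then have "2 * (\<gamma> - 1) * ((total_energy \<gamma> L + pres L) * vel L) + 2 * (\<gamma> - 1) * Q =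
      2 * (\<gamma> - 1) * ((total_energy \<gamma> R + pres R) * vel R)"
    by (metis distrib_left)
  then have "2 * (\<gamma> - 1) * Q = 2 * \<gamma> * (P - m * vel R) * vel R + (\<gamma> - 1) * m * (vel R)\<^sup>2
      - (2 * \<gamma> * (P - m * vel L) * vel L + (\<gamma> - 1) * m * (vel L)\<^sup>2)"
    unfolding eL eR by linarith
  then have "(\<gamma> + 1) * m * (2 * (\<gamma> - 1) * Q) = (\<gamma> + 1) * m *
      (2 * \<gamma> * (P - m * vel R) * vel R + (\<gamma> - 1) * m * (vel R)\<^sup>2
      - (2 * \<gamma> * (P - m * vel L) * vel L + (\<gamma> - 1) * m * (vel L)\<^sup>2))"
    by simp
  then show ?thesis
    unfolding g m_def[symmetric] by (simp add: power2_eq_square algebra_simps)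
qed

text \<open>The square identity only bounds the modulus of the downstream gap; the physical branch fixes
  its sign, and the linear identity then orders the pressures.\<close>

lemma forward_heating:
  assumes "1 < \<gamma>" "Q > 0" "is_state L" "is_state R" "heating_discontinuity \<gamma> Q L R" "vel L > 0"
  shows "(sonic_gap \<gamma> L > 0 \<and> sonic_gap \<gamma> R \<ge> 0 \<and> pres R < pres L \<and> vel L < vel R) \<or>
         (sonic_gap \<gamma> L < 0 \<and> sonic_gap \<gamma> R \<le> 0 \<and> pres L < pres R \<and> vel R < vel L)"
proof -
  have J: "heating_jump \<gamma> Q L R" and B: "physical_branch \<gamma> L R"
    using assms(5) by (auto simp: heating_discontinuity_def)
  have m: "dens L * vel L > 0" using assms by (simp add: is_state_def)
  have "\<gamma>\<^sup>2 - 1 > 0" using assms(1) by (simp add: one_less_power)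
  then have "2 * (\<gamma>\<^sup>2 - 1) * (dens L * vel L) * Q > 0"
    using m assms(2) by simp
  then have "(sonic_gap \<gamma> R)\<^sup>2 < (sonic_gap \<gamma> L)\<^sup>2"
    using heating_jump_gap_squares[OF assms(1,3,4) J] by linarith
  then have abs: "\<bar>sonic_gap \<gamma> R\<bar> < \<bar>sonic_gap \<gamma> L\<bar>"
    using power2_less_imp_less[of "\<bar>sonic_gap \<gamma> R\<bar>" "\<bar>sonic_gap \<gamma> L\<bar>"] by simp
  have br: "sonic_gap \<gamma> L > 0 \<Longrightarrow> sonic_gap \<gamma> R \<ge> 0" "sonic_gap \<gamma> L < 0 \<Longrightarrow> sonic_gap \<gamma> R \<le> 0"
    using B assms(6) abs_mach_less_1_iff[OF assms(1,3)] abs_mach_greater_1_iff[OF assms(1,3)]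
      abs_mach_less_1_iff[OF assms(1,4)] abs_mach_greater_1_iff[OF assms(1,4)]
    by (auto simp: physical_branch_def Let_def not_less[symmetric])
  have d: "sonic_gap \<gamma> L - sonic_gap \<gamma> R = (\<gamma> + 1) * (pres L - pres R)"
    using heating_jump_gap_difference[OF J] .
  have pu: "pres L - pres R = dens L * vel L * (vel R - vel L)"
    using heating_jump_pressure_velocity[OF J] .
  have p1: "pres R < pres L \<longleftrightarrow> sonic_gap \<gamma> R < sonic_gap \<gamma> L"
    and p2: "pres L < pres R \<longleftrightarrow> sonic_gap \<gamma> L < sonic_gap \<gamma> R"
    using d assms(1) zero_less_mult_iff[of "\<gamma> + 1" "pres L - pres R"]
      mult_less_0_iff[of "\<gamma> + 1" "pres L - pres R"] by linarith+
  have u1: "pres R < pres L \<Longrightarrow> vel L < vel R" and u2: "pres L < pres R \<Longrightarrow> vel R < vel L"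
    using pu m zero_less_mult_iff[of "dens L * vel L" "vel R - vel L"]
      mult_less_0_iff[of "dens L * vel L" "vel R - vel L"] by linarith+
  show ?thesis using abs br p1 p2 u1 u2 by linarith
qed

lemma backward_subsonic_heating:
  assumes "1 < \<gamma>" "Q > 0" "is_state L" "is_state R" "heating_discontinuity \<gamma> Q L R" "vel L < 0"
    and "sonic_gap \<gamma> R \<ge> 0"
  shows "sonic_gap \<gamma> L \<ge> 0 \<and> pres L < pres R"
proof -
  have J: "heating_jump \<gamma> Q L R" and B: "physical_branch \<gamma> L R"
    using assms(5) by (auto simp: heating_discontinuity_def)
  have m: "dens L * vel L < 0" using assms by (simp add: is_state_def mult_pos_neg)
  have "\<gamma>\<^sup>2 - 1 > 0" using assms(1) by (simp add: one_less_power)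
  then have "2 * (\<gamma>\<^sup>2 - 1) * (dens L * vel L) * Q < 0"
    using m assms(2) by (simp add: mult_less_0_iff)
  then have "(sonic_gap \<gamma> L)\<^sup>2 < (sonic_gap \<gamma> R)\<^sup>2"
    using heating_jump_gap_squares[OF assms(1,3,4) J] by linarith
  then have "\<bar>sonic_gap \<gamma> L\<bar> < sonic_gap \<gamma> R"
    using assms(7) power2_less_imp_less[of "\<bar>sonic_gap \<gamma> L\<bar>" "sonic_gap \<gamma> R"] by simp
  then have lt: "sonic_gap \<gamma> L < sonic_gap \<gamma> R" and pos: "sonic_gap \<gamma> R > 0"
    by auto
  have "sonic_gap \<gamma> L \<ge> 0"
    using B assms(6) pos abs_mach_greater_1_iff[OF assms(1,3)] abs_mach_less_1_iff[OF assms(1,4)]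
    by (auto simp: physical_branch_def Let_def not_less[symmetric])
  moreover have "pres L < pres R"
    using heating_jump_gap_difference[OF J] lt assms(1)
      mult_less_0_iff[of "\<gamma> + 1" "pres L - pres R"] by auto
  ultimately show ?thesis by simp
qed

section \<open>Shocks and contacts\<close>

lemma rankine_hugoniot_mass_momentum:
  assumes "rankine_hugoniot \<gamma> s L R"
  shows "dens R * (vel R - s) = dens L * (vel L - s)"
    and "pres R - pres L = dens L * (vel L - s) * (vel L - vel R)"
proof -
  have mass: "dens R * vel R - dens L * vel L = s * (dens R - dens L)"
    and mom: "dens R * (vel R)\<^sup>2 + pres R - (dens L * (vel L)\<^sup>2 + pres L) =
      s * (dens R * vel R - dens L * vel L)"
    using assms by (auto simp: rankine_hugoniot_def flux_def conserved_def)
  show *: "dens R * (vel R - s) = dens L * (vel L - s)" using mass by (simp add: algebra_simps)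
  have "pres R - pres L = dens L * (vel L - s) * vel L - dens R * (vel R - s) * vel R"
    using mom by (simp add: power2_eq_square algebra_simps)
  then show "pres R - pres L = dens L * (vel L - s) * (vel L - vel R)"
    unfolding * by (simp add: algebra_simps)
qed

text \<open>In the frame of the shock, the Lax condition says that gas enters supersonically and leaves
  subsonically. With the mass flux common to both sides, momentum balance then forces the gas
  to slow down and the pressure to rise. The last claim compares the mass flux through a shock that
  does not move to the right with the mass flux through a point at rest behind it.\<close>

lemma shock_1_monotone:
  assumes "1 < \<gamma>" "is_state L" "is_state R" "shock \<gamma> 1 s L R"
  shows "vel R < vel L" "pres L < pres R"
    and "s \<le> 0 \<Longrightarrow> dens R * vel R * (vel L - vel R) \<le> pres R - pres L"
proof -
  have rh: "rankine_hugoniot \<gamma> s L R" and vR: "vel R - s < sound_speed \<gamma> R"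
    and vL: "sound_speed \<gamma> L < vel L - s"
    using assms(4) unfolding shock_def char_speed_1 by auto
  define j where "j = dens L * (vel L - s)"
  have jR: "dens R * (vel R - s) = j" and p: "pres R - pres L = j * (vel L - vel R)"
    using rankine_hugoniot_mass_momentum[OF rh] by (simp_all add: j_def)
  have aL: "sound_speed \<gamma> L > 0" and dL: "dens L > 0" and dR: "dens R > 0"
    using sound_speed_pos[OF assms(1,2)] assms by (auto simp: is_state_def)
  have j: "j > 0" using aL vL dL by (simp add: j_def)
  then have vR0: "vel R - s > 0" using jR dR by (metis zero_less_mult_pos)
  have "dens L * (sound_speed \<gamma> L)\<^sup>2 < dens L * (vel L - s)\<^sup>2"
    using dL vL aL by (intro mult_strict_left_mono power_strict_mono) auto
  then have sup: "\<gamma> * pres L < j * (vel L - s)"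
    using dens_sound_speed_squared[OF assms(1,2)] by (simp add: j_def power2_eq_square)
  have "dens R * (vel R - s)\<^sup>2 < dens R * (sound_speed \<gamma> R)\<^sup>2"
    using dR vR vR0 by (intro mult_strict_left_mono power_strict_mono) auto
  then have sub: "j * (vel R - s) < \<gamma> * pres R"
    using dens_sound_speed_squared[OF assms(1,3)] by (simp add: jR[symmetric] power2_eq_square)
  show v: "vel R < vel L"
  proof (rule ccontr)
    assume "\<not> vel R < vel L"
    then have "j * (vel L - s) \<le> j * (vel R - s)" "j * (vel L - vel R) \<le> 0"
      using j by (auto intro: mult_left_mono simp: mult_le_0_iff)
    then have "\<gamma> * pres L < \<gamma> * pres R" "pres R \<le> pres L" using sup sub p by linarith+
    then show False using assms(1) by (simp add: mult_less_cancel_left)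
  qed
  then show "pres L < pres R" using p j by (metis diff_gt_0_iff_gt mult_pos_pos)
  show "dens R * vel R * (vel L - vel R) \<le> pres R - pres L" if "s \<le> 0"
  proof -
    have "dens R * vel R \<le> j" using that dR by (simp add: jR[symmetric] right_diff_distrib mult_le_0_iff)
    then show ?thesis unfolding p using v by (intro mult_right_mono) auto
  qed
qed

lemma shock_3_monotone:
  assumes "1 < \<gamma>" "is_state L" "is_state R" "shock \<gamma> 3 s L R"
  shows "vel R < vel L" "pres R < pres L"
proof -
  have rh: "rankine_hugoniot \<gamma> s L R" and vR: "sound_speed \<gamma> R < s - vel R"
    and vL: "s - vel L < sound_speed \<gamma> L"
    using assms(4) unfolding shock_def char_speed_3 by auto
  define j where "j = dens R * (s - vel R)"
  have jL: "dens L * (s - vel L) = j"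
    using rankine_hugoniot_mass_momentum(1)[OF rh] by (simp add: j_def algebra_simps)
  have p: "pres L - pres R = j * (vel L - vel R)"
    using rankine_hugoniot_mass_momentum(2)[OF rh] by (simp add: jL[symmetric] algebra_simps)
  have aR: "sound_speed \<gamma> R > 0" and dL: "dens L > 0" and dR: "dens R > 0"
    using sound_speed_pos[OF assms(1,3)] assms by (auto simp: is_state_def)
  have j: "j > 0" using aR vR dR by (simp add: j_def)
  then have vL0: "s - vel L > 0" using jL dL by (metis zero_less_mult_pos)
  have "dens R * (sound_speed \<gamma> R)\<^sup>2 < dens R * (s - vel R)\<^sup>2"
    using dR vR aR by (intro mult_strict_left_mono power_strict_mono) auto
  then have sup: "\<gamma> * pres R < j * (s - vel R)"
    using dens_sound_speed_squared[OF assms(1,3)] by (simp add: j_def power2_eq_square)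
  have "dens L * (s - vel L)\<^sup>2 < dens L * (sound_speed \<gamma> L)\<^sup>2"
    using dL vL vL0 by (intro mult_strict_left_mono power_strict_mono) auto
  then have sub: "j * (s - vel L) < \<gamma> * pres L"
    using dens_sound_speed_squared[OF assms(1,2)] by (simp add: jL[symmetric] power2_eq_square)
  show "vel R < vel L"
  proof (rule ccontr)
    assume "\<not> vel R < vel L"
    then have "j * (s - vel R) \<le> j * (s - vel L)" "j * (vel L - vel R) \<le> 0"
      using j by (auto intro: mult_left_mono simp: mult_le_0_iff)
    then have "\<gamma> * pres R < \<gamma> * pres L" "pres L \<le> pres R" using sup sub p by linarith+
    then show False using assms(1) by (simp add: mult_less_cancel_left)
  qed
  then show "pres R < pres L" using p j by (metis diff_gt_0_iff_gt mult_pos_pos)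
qed

lemma contact_wave_continuity:
  assumes "contact_wave \<gamma> V \<sigma> L R"
  shows "vel R = vel L" "pres R = pres L" "L = R \<or> contact_connected \<gamma> L R"
    "L = R \<or> \<sigma> = vel R"
  using assms rankine_hugoniot_mass_momentum(2)[of \<gamma> \<sigma> L R]
  by (auto simp: contact_wave_def contact_def contact_connected_def)

section \<open>Rarefaction waves\<close>

text \<open>With \<open>c = \<xi> - u\<close>, which is \<open>-a\<close> or \<open>a\<close> according to the field, balance of mass and momentum
  gives \<open>\<rho> u' = c \<rho>'\<close> and \<open>p' = c\<^sup>2 \<rho>'\<close>. Differentiating \<open>c\<^sup>2 \<rho> = \<gamma> p\<close> then makes \<open>u'\<close> a
  constant.\<close>

lemma rarefaction_derivatives:
  assumes "1 < \<gamma>" "k = 1 \<or> k = 3" "rarefaction \<gamma> k V L R"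
    and \<xi>: "\<xi> \<in> {char_speed \<gamma> k L<..<char_speed \<gamma> k R}"
  shows "((\<lambda>\<eta>. vel (V \<eta>)) has_real_derivative 2 / (\<gamma> + 1)) (at \<xi>)"
    and "((\<lambda>\<eta>. pres (V \<eta>)) has_real_derivative
          dens (V \<xi>) * (\<xi> - vel (V \<xi>)) * (2 / (\<gamma> + 1))) (at \<xi>)"
    and "((\<lambda>\<eta>. dens (V \<eta>) * (\<eta> - vel (V \<eta>))) has_real_derivative dens (V \<xi>)) (at \<xi>)"
proof -
  let ?I = "{char_speed \<gamma> k L<..<char_speed \<gamma> k R}"
  define \<rho> u p where "\<rho> = (\<lambda>\<eta>. dens (V \<eta>))" and "u = (\<lambda>\<eta>. vel (V \<eta>))" and "p = (\<lambda>\<eta>. pres (V \<eta>))"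
  have st: "is_state (V \<eta>)" and cs: "char_speed \<gamma> k (V \<eta>) = \<eta>" if "\<eta> \<in> ?I" for \<eta>
    using assms(3) that by (auto simp: rarefaction_def)
  have pos: "\<rho> \<eta> > 0" if "\<eta> \<in> ?I" for \<eta> using st[OF that] by (simp add: \<rho>_def is_state_def)
  have c0: "\<eta> - u \<eta> \<noteq> 0" and cc: "(\<eta> - u \<eta>)\<^sup>2 * \<rho> \<eta> = \<gamma> * p \<eta>" if "\<eta> \<in> ?I" for \<eta>
  proof -
    have "\<eta> - u \<eta> = sound_speed \<gamma> (V \<eta>) \<or> \<eta> - u \<eta> = - sound_speed \<gamma> (V \<eta>)"
      using assms(2) cs[OF that] by (auto simp: u_def char_speed_def)
    then show "\<eta> - u \<eta> \<noteq> 0" "(\<eta> - u \<eta>)\<^sup>2 * \<rho> \<eta> = \<gamma> * p \<eta>"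
      using sound_speed_pos[OF assms(1) st[OF that]] dens_sound_speed_squared[OF assms(1) st[OF that]]
      by (auto simp: \<rho>_def p_def mult.commute)
  qed
  obtain D where D: "((\<lambda>\<eta>. conserved \<gamma> (V \<eta>)) has_vector_derivative D) (at \<xi>)"
    "((\<lambda>\<eta>. flux \<gamma> (V \<eta>)) has_vector_derivative \<xi> *\<^sub>R D) (at \<xi>)"
    using assms(3) \<xi> unfolding rarefaction_def by blast
  define r q where "r = fst D" and "q = fst (snd D)"
  have d\<rho>: "(\<rho> has_real_derivative r) (at \<xi>)"
    using bounded_linear.has_vector_derivative[OF bounded_linear_fst D(1)]
    by (simp add: has_real_derivative_iff_has_vector_derivative conserved_def \<rho>_def r_def)
  have dm: "((\<lambda>\<eta>. \<rho> \<eta> * u \<eta>) has_real_derivative q) (at \<xi>)"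
    using bounded_linear.has_vector_derivative[OF bounded_linear_fst
        bounded_linear.has_vector_derivative[OF bounded_linear_snd D(1)]]
    by (simp add: has_real_derivative_iff_has_vector_derivative conserved_def \<rho>_def u_def q_def)
  have "((\<lambda>\<eta>. \<rho> \<eta> * u \<eta>) has_real_derivative \<xi> * r) (at \<xi>)"
    using bounded_linear.has_vector_derivative[OF bounded_linear_fst D(2)]
    by (simp add: has_real_derivative_iff_has_vector_derivative flux_def \<rho>_def u_def r_def)
  then have q: "q = \<xi> * r" using dm DERIV_unique by blast
  have dF: "((\<lambda>\<eta>. \<rho> \<eta> * (u \<eta>)\<^sup>2 + p \<eta>) has_real_derivative \<xi> * q) (at \<xi>)"
    using bounded_linear.has_vector_derivative[OF bounded_linear_fst
        bounded_linear.has_vector_derivative[OF bounded_linear_snd D(2)]]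
    by (simp add: has_real_derivative_iff_has_vector_derivative flux_def \<rho>_def u_def p_def q_def)
  define c where "c = \<xi> - u \<xi>"
  have \<rho>0: "\<rho> \<xi> > 0" and cn: "c \<noteq> 0" using pos[OF \<xi>] c0[OF \<xi>] by (auto simp: c_def)
  have "((\<lambda>\<eta>. (\<rho> \<eta> * u \<eta>) / \<rho> \<eta>) has_real_derivative c * r / \<rho> \<xi>) (at \<xi>)"
    by (rule DERIV_cong[OF DERIV_divide[OF dm d\<rho>]])
       (use \<rho>0 in \<open>simp_all add: q c_def field_simps\<close>)
  then have du: "(u has_real_derivative c * r / \<rho> \<xi>) (at \<xi>)"
    by (rule has_field_derivative_transform_within_open[of _ _ _ ?I]) (use \<xi> pos in force)+
  define u' where "u' = c * r / \<rho> \<xi>"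
  have r: "r = \<rho> \<xi> * u' / c" using cn \<rho>0 by (simp add: u'_def)
  have "((\<lambda>\<eta>. (\<rho> \<eta> * (u \<eta>)\<^sup>2 + p \<eta>) - (\<rho> \<eta> * u \<eta>) * u \<eta>) has_real_derivative
      \<xi> * q - (q * u \<xi> + (\<rho> \<xi> * u \<xi>) * u')) (at \<xi>)"
    by (rule DERIV_cong[OF DERIV_diff[OF dF DERIV_mult[OF dm du]]]) (simp add: u'_def)
  moreover have "(\<lambda>\<eta>. (\<rho> \<eta> * (u \<eta>)\<^sup>2 + p \<eta>) - (\<rho> \<eta> * u \<eta>) * u \<eta>) = p"
    by (simp add: power2_eq_square algebra_simps)
  moreover have "\<xi> * q - (q * u \<xi> + (\<rho> \<xi> * u \<xi>) * u') = \<rho> \<xi> * c * u'"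
  proof -
    have "\<xi> = u \<xi> + c" by (simp add: c_def)
    then show ?thesis using cn unfolding q r by (simp add: field_simps) algebra
  qed
  ultimately have dp: "(p has_real_derivative \<rho> \<xi> * c * u') (at \<xi>)" by simp
  have "((\<lambda>\<eta>. (\<eta> - u \<eta>)\<^sup>2 * \<rho> \<eta> - \<gamma> * p \<eta>) has_real_derivative
      2 * c * (1 - u') * \<rho> \<xi> + c\<^sup>2 * r - \<gamma> * (\<rho> \<xi> * c * u')) (at \<xi>)"
    by (auto intro!: derivative_eq_intros d\<rho> du dp simp: u'_def c_def)
  moreover have "((\<lambda>\<eta>. (\<eta> - u \<eta>)\<^sup>2 * \<rho> \<eta> - \<gamma> * p \<eta>) has_real_derivative 0) (at \<xi>)"
    by (rule has_field_derivative_transform_within_open[of "\<lambda>_. 0" _ _ ?I]) (use \<xi> cc in auto)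
  ultimately have "2 * c * (1 - u') * \<rho> \<xi> + c\<^sup>2 * r - \<gamma> * (\<rho> \<xi> * c * u') = 0"
    using DERIV_unique by blast
  then have "c * \<rho> \<xi> * (2 - (\<gamma> + 1) * u') = 0"
    using cn unfolding r by (simp add: power2_eq_square algebra_simps)
  then have "2 - (\<gamma> + 1) * u' = 0" using cn \<rho>0 by (metis less_irrefl mult_eq_0_iff)
  then have u': "u' = 2 / (\<gamma> + 1)" using assms(1) by (simp add: field_simps)
  show "((\<lambda>\<eta>. vel (V \<eta>)) has_real_derivative 2 / (\<gamma> + 1)) (at \<xi>)"
    using du by (simp add: u_def u'[symmetric] u'_def)
  show "((\<lambda>\<eta>. pres (V \<eta>)) has_real_derivative
      dens (V \<xi>) * (\<xi> - vel (V \<xi>)) * (2 / (\<gamma> + 1))) (at \<xi>)"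
    using dp by (simp add: u' p_def \<rho>_def c_def u_def)
  have "((\<lambda>\<eta>. \<rho> \<eta> * (\<eta> - u \<eta>)) has_real_derivative r * c + \<rho> \<xi> * (1 - u')) (at \<xi>)"
    by (auto intro!: derivative_eq_intros d\<rho> du simp: u'_def c_def)
  moreover have "r * c + \<rho> \<xi> * (1 - u') = \<rho> \<xi>" using cn by (simp add: r algebra_simps)
  ultimately show "((\<lambda>\<eta>. dens (V \<eta>) * (\<eta> - vel (V \<eta>))) has_real_derivative dens (V \<xi>)) (at \<xi>)"
    by (simp add: \<rho>_def u_def)
qed

lemma rarefaction_continuous:
  assumes "rarefaction \<gamma> k V L R"
  defines "I \<equiv> {char_speed \<gamma> k L..char_speed \<gamma> k R}"
  shows "continuous_on I (\<lambda>\<eta>. dens (V \<eta>))" "continuous_on I (\<lambda>\<eta>. vel (V \<eta>))"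
    "continuous_on I (\<lambda>\<eta>. pres (V \<eta>))"
  using assms(1) unfolding rarefaction_def I_def dens_def vel_def pres_def
  by (auto intro!: continuous_intros)

lemma rarefaction_vel_increasing:
  assumes "1 < \<gamma>" "k = 1 \<or> k = 3" "rarefaction \<gamma> k V L R"
  shows "vel L < vel R"
proof -
  have ends: "char_speed \<gamma> k L < char_speed \<gamma> k R" "V (char_speed \<gamma> k L) = L"
    "V (char_speed \<gamma> k R) = R"
    using assms(3) by (auto simp: rarefaction_def)
  have "vel (V (char_speed \<gamma> k L)) < vel (V (char_speed \<gamma> k R))"
  proof (rule DERIV_pos_imp_increasing_open[OF ends(1) _ rarefaction_continuous(2)[OF assms(3)]])
    fix x assume "char_speed \<gamma> k L < x" "x < char_speed \<gamma> k R"
    then show "\<exists>y. ((\<lambda>\<eta>. vel (V \<eta>)) has_real_derivative y) (at x) \<and> 0 < y"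
      using rarefaction_derivatives(1)[OF assms, of x] assms(1)
      by (intro exI[of _ "2 / (\<gamma> + 1)"]) auto
  qed
  then show ?thesis by (simp add: ends)
qed

lemma rarefaction_3_pres_increasing:
  assumes "1 < \<gamma>" "rarefaction \<gamma> 3 V L R"
  shows "pres L < pres R"
proof -
  have ends: "char_speed \<gamma> 3 L < char_speed \<gamma> 3 R" "V (char_speed \<gamma> 3 L) = L"
    "V (char_speed \<gamma> 3 R) = R"
    using assms(2) by (auto simp: rarefaction_def)
  have "pres (V (char_speed \<gamma> 3 L)) < pres (V (char_speed \<gamma> 3 R))"
  proof (rule DERIV_pos_imp_increasing_open[OF ends(1) _ rarefaction_continuous(3)[OF assms(2)]])
    fix x assume x: "char_speed \<gamma> 3 L < x" "x < char_speed \<gamma> 3 R"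
    then have st: "is_state (V x)" "char_speed \<gamma> 3 (V x) = x"
      using assms(2) by (auto simp: rarefaction_def)
    then have "dens (V x) > 0" "x - vel (V x) > 0"
      using sound_speed_pos[OF assms(1) st(1)] by (auto simp: is_state_def char_speed_3)
    then show "\<exists>y. ((\<lambda>\<eta>. pres (V \<eta>)) has_real_derivative y) (at x) \<and> 0 < y"
      using rarefaction_derivatives(2)[OF assms(1) _ assms(2), of x] assms(1) x
      by (intro exI[of _ "dens (V x) * (x - vel (V x)) * (2 / (\<gamma> + 1))"]) simp
  qed
  then show ?thesis by (simp add: ends)
qed

text \<open>Along the fan \<open>dp = - \<rho> a du\<close>, and \<open>\<rho> a\<close> decreases, so its value at the left end bounds the
  pressure drop per unit of velocity gained.\<close>

lemma rarefaction_1_pressure_drop: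
  assumes "1 < \<gamma>" "rarefaction \<gamma> 1 V L R"
  shows "pres R < pres L" "pres L - pres R \<le> dens L * sound_speed \<gamma> L * (vel R - vel L)"
proof -
  define \<alpha> \<beta> where "\<alpha> = char_speed \<gamma> 1 L" and "\<beta> = char_speed \<gamma> 1 R"
  have ends: "\<alpha> < \<beta>" "V \<alpha> = L" "V \<beta> = R"
    using assms(2) by (auto simp: rarefaction_def \<alpha>_def \<beta>_def)
  have st: "is_state (V x)" "x - vel (V x) = - sound_speed \<gamma> (V x)" if "x \<in> {\<alpha>..\<beta>}" for x
  proof -
    have "is_state (V x) \<and> char_speed \<gamma> 1 (V x) = x"
      using assms(2) that unfolding rarefaction_def \<alpha>_def \<beta>_def by blast
    then show "is_state (V x)" "x - vel (V x) = - sound_speed \<gamma> (V x)"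
      unfolding char_speed_1 by auto
  qed
  note der = rarefaction_derivatives[OF assms(1) _ assms(2), folded \<alpha>_def \<beta>_def, simplified]
  note con = rarefaction_continuous[OF assms(2), folded \<alpha>_def \<beta>_def]
  have "- pres (V \<alpha>) < - pres (V \<beta>)"
  proof (rule DERIV_pos_imp_increasing_open[OF ends(1)])
    fix x assume x: "\<alpha> < x" "x < \<beta>"
    then have "dens (V x) > 0" "x - vel (V x) < 0"
      using st[of x] sound_speed_pos[OF assms(1) st(1), of x] by (auto simp: is_state_def)
    then have "0 < - (dens (V x) * (x - vel (V x)) * (2 / (\<gamma> + 1)))"
      using assms(1) by (simp add: mult_less_0_iff divide_less_0_iff)
    then show "\<exists>y. ((\<lambda>x. - pres (V x)) has_real_derivative y) (at x) \<and> 0 < y"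
      using der(2)[of x] x by (intro exI conjI) (auto intro: DERIV_minus)
  qed (intro con continuous_intros)
  then show "pres R < pres L" by (simp add: ends)
  define f where "f = (\<lambda>x. dens (V x) * (x - vel (V x)))"
  have f\<alpha>: "f \<alpha> = - (dens L * sound_speed \<gamma> L)" using st(2)[of \<alpha>] ends by (simp add: f_def)
  have incr: "f \<alpha> < f x" if "\<alpha> < x" "x < \<beta>" for x
    using that(1)
  proof (rule DERIV_pos_imp_increasing_open)
    fix y assume y: "\<alpha> < y" "y < x"
    then show "\<exists>z. (f has_real_derivative z) (at y) \<and> 0 < z"
      using der(3)[of y] st(1)[of y] that unfolding f_def
      by (intro exI[of _ "dens (V y)"]) (auto simp: is_state_def)
  next
    show "continuous_on {\<alpha>..x} f"
      unfolding f_def using that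
      by (intro continuous_intros continuous_on_subset[OF con(1)] continuous_on_subset[OF con(2)]) auto
  qed
  have "pres (V \<alpha>) - f \<alpha> * vel (V \<alpha>) < pres (V \<beta>) - f \<alpha> * vel (V \<beta>)"
  proof (rule DERIV_pos_imp_increasing_open[OF ends(1)])
    fix x assume x: "\<alpha> < x" "x < \<beta>"
    have "((\<lambda>x. pres (V x) - f \<alpha> * vel (V x)) has_real_derivative
        f x * (2 / (\<gamma> + 1)) - f \<alpha> * (2 / (\<gamma> + 1))) (at x)"
      using der(1,2)[of x] x unfolding f_def by (auto intro!: derivative_eq_intros)
    moreover have "f \<alpha> * (2 / (\<gamma> + 1)) < f x * (2 / (\<gamma> + 1))"
      using incr[OF x] assms(1) by (intro mult_strict_right_mono) auto
    ultimately show "\<exists>y. ((\<lambda>x. pres (V x) - f \<alpha> * vel (V x)) has_real_derivative y) (at x) \<and> 0 < y"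
      by (intro exI conjI) auto
  qed (intro con continuous_intros)
  then show "pres L - pres R \<le> dens L * sound_speed \<gamma> L * (vel R - vel L)"
    by (simp add: ends f\<alpha> algebra_simps)
qed

section \<open>Wave fans on one side of the heating point\<close>

lemma wave_3_comonotone:
  assumes "1 < \<gamma>" "is_state L" "is_state R" "nonlinear_wave \<gamma> 3 V \<sigma> \<tau> L R"
  shows "L = R \<or>
    (shock_connected \<gamma> 3 L R \<and> vel R < vel L \<and> pres R < pres L) \<or>
    (rarefaction_connected \<gamma> 3 L R \<and> vel L < vel R \<and> pres L < pres R)"
  using assms(4) shock_3_monotone[OF assms(1-3)] rarefaction_vel_increasing[OF assms(1), of 3 V L R]
    rarefaction_3_pres_increasing[OF assms(1), of V L R]
  unfolding nonlinear_wave_def shock_connected_def rarefaction_connected_def by blast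

lemma crp_solution_waves:
  assumes "crp_solution \<gamma> V \<sigma>1 \<tau>1 \<sigma>2 \<sigma>3 \<tau>3 A B C D"
  shows "is_state A" "is_state B" "is_state C" "is_state D"
    "\<sigma>1 \<le> \<tau>1" "\<tau>1 \<le> \<sigma>2" "\<sigma>2 \<le> \<sigma>3" "\<sigma>3 \<le> \<tau>3"
    "nonlinear_wave \<gamma> 1 V \<sigma>1 \<tau>1 A B" "contact_wave \<gamma> V \<sigma>2 B C" "nonlinear_wave \<gamma> 3 V \<sigma>3 \<tau>3 C D"
  using assms unfolding crp_solution_def by blast+

text \<open>Where the flow at the heating point is to the right, waves of the fields \<open>u\<close> and \<open>u + a\<close> next to
  it would have positive speed.\<close>

lemma left_fan_forward:
  assumes "1 < \<gamma>" "crp_solution \<gamma> V \<sigma>1 \<tau>1 \<sigma>2 \<sigma>3 \<tau>3 A B C D" "\<tau>3 \<le> 0" "vel D > 0"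
  shows "B = D" "C = D"
    "A = D \<or> (\<exists>s\<le>0. shock \<gamma> 1 s A D) \<or> (rarefaction_connected \<gamma> 1 A D \<and> char_speed \<gamma> 1 D \<le> 0)"
proof -
  note crp = crp_solution_waves[OF assms(2)]
  have "char_speed \<gamma> 3 D > 0"
    using sound_speed_pos[OF assms(1), of D] crp assms(4) unfolding char_speed_3 by simp
  then show C: "C = D"
    using crp assms(3) unfolding nonlinear_wave_def shock_def by auto
  then show B: "B = D"
    using contact_wave_continuity(4)[of \<gamma> V \<sigma>2 B C] crp assms(3,4) by auto
  have "nonlinear_wave \<gamma> 1 V \<sigma>1 \<tau>1 A D" "\<tau>1 \<le> 0" using crp assms(3) B by auto
  then show "A = D \<or> (\<exists>s\<le>0. shock \<gamma> 1 s A D) \<or>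
      (rarefaction_connected \<gamma> 1 A D \<and> char_speed \<gamma> 1 D \<le> 0)"
    unfolding nonlinear_wave_def rarefaction_connected_def by blast
qed

text \<open>Gas that flows backwards through the heating point is impossible. All waves emitted to the
  right would have to be the single rarefaction that reverses the velocity, so the inflow is subsonic
  at a pressure below the initial one, and heating lowers the pressure further. On the left,
  however, the reversal takes a shock raising the pressure from left to right, and any further
  pressure change up to the heating point, by a rarefaction of the third field, is again a rise.\<close>

lemma no_backflow:
  assumes "1 < \<gamma>" "Q > 0" "vel A > 0"
    and "crp_solution \<gamma> V \<sigma>1 \<tau>1 \<sigma>2 \<sigma>3 \<tau>3 A B C D" "\<tau>3 \<le> 0"
    and "crp_solution \<gamma> V' \<sigma>1' \<tau>1' \<sigma>2' \<sigma>3' \<tau>3' D' C' B' A" "0 \<le> \<sigma>1'"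
    and "heating_discontinuity \<gamma> Q D D'"
  shows "\<not> vel D < 0"
proof
  assume neg: "vel D < 0"
  note l = crp_solution_waves[OF assms(4)] and r = crp_solution_waves[OF assms(6)]
  have st: "is_state A" "is_state B" "is_state C" "is_state D" "is_state D'" "is_state C'"
    "is_state B'" using l r by auto
  have neg': "vel D' < 0"
    using heating_jump_vel_sign(2)[of \<gamma> Q D D'] assms(8) st neg by (auto simp: heating_discontinuity_def)
  have "char_speed \<gamma> 1 D' < 0"
    using sound_speed_pos[OF assms(1) st(5)] neg' unfolding char_speed_1 by simp
  then have C': "C' = D'"
    using r assms(7) unfolding nonlinear_wave_def shock_def by auto
  have cw: "contact_wave \<gamma> V' \<sigma>2' D' B'" using r(10) C' by simp
  have "\<sigma>2' \<noteq> vel B'"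
    using contact_wave_continuity(1)[OF cw] r(5,6) assms(7) neg' by linarith
  then have B': "B' = D'" using contact_wave_continuity(4)[OF cw] by simp
  have w3: "nonlinear_wave \<gamma> 3 V' \<sigma>3' \<tau>3' D' A" "0 \<le> \<sigma>3'"
    using r(5-7,11) assms(7) unfolding B' by auto
  have pA: "pres D' < pres A"
    using wave_3_comonotone[OF assms(1) st(5,1) w3(1)] neg' assms(3) by auto
  have "0 \<le> char_speed \<gamma> 3 D'"
    using w3 shock_3_monotone(1)[OF assms(1) st(5,1), of \<sigma>3'] neg' assms(3)
    by (auto simp: nonlinear_wave_def)
  then have "\<not> sonic_gap \<gamma> D' < 0"
    using neg' sonic_gap_neg_iff[OF assms(1) st(5)] unfolding char_speed_3 by simp
  then have heat: "sonic_gap \<gamma> D \<ge> 0" "pres D < pres D'"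
    using backward_subsonic_heating[OF assms(1,2) st(4,5) assms(8) neg] by auto
  then have "char_speed \<gamma> 3 D \<ge> 0"
    using neg sonic_gap_neg_iff[OF assms(1) st(4)] unfolding char_speed_3 by simp
  then have "\<not> shock \<gamma> 3 \<sigma>3 C D" using l(8) assms(5) unfolding shock_def by linarith
  moreover have "nonlinear_wave \<gamma> 3 V \<sigma>3 \<tau>3 C D" by (fact l(11))
  ultimately have C: "vel C \<le> vel D" "pres C \<le> pres D"
    using rarefaction_vel_increasing[OF assms(1), of 3 V C D]
      rarefaction_3_pres_increasing[OF assms(1), of V C D]
    unfolding nonlinear_wave_def by auto
  have BC: "vel C = vel B" "pres C = pres B"
    using contact_wave_continuity(1,2)[OF l(10)] by simp_all
  have "vel B < vel A" using BC C neg assms(3) by linarith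
  then have "shock \<gamma> 1 \<sigma>1 A B"
    using l(9) rarefaction_vel_increasing[OF assms(1), of 1 V A B] unfolding nonlinear_wave_def
    by auto
  then have "pres A < pres B" using shock_1_monotone(2)[OF assms(1) st(1,2)] by blast
  then show False using BC C heat pA by linarith
qed

text \<open>The 1-wave that leaves the heating point to the right with the flow, when it is not a shock:
  a fan of nonnegative speed starts sonic or supersonic, so \<open>\<rho> a\<close> there is at most the mass
  flux.\<close>

lemma downstream_rarefaction_1_bound:
  assumes "1 < \<gamma>" "is_state L"
    and "L = R \<or> (rarefaction_connected \<gamma> 1 L R \<and> 0 \<le> char_speed \<gamma> 1 L)"
  shows "vel L \<le> vel R" "pres R \<le> pres L" "pres L - pres R \<le> dens L * vel L * (vel R - vel L)"
proof -
  have "vel L \<le> vel R \<and> pres R \<le> pres L \<and> pres L - pres R \<le> dens L * vel L * (vel R - vel L)"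
    if V: "rarefaction \<gamma> 1 V L R" and a: "0 \<le> char_speed \<gamma> 1 L" for V
  proof -
    have u: "vel L < vel R" by (rule rarefaction_vel_increasing[OF assms(1) _ V]) simp
    have "dens L * sound_speed \<gamma> L \<le> dens L * vel L"
      using assms(2) a unfolding char_speed_1 is_state_def by (intro mult_left_mono) auto
    then have "dens L * sound_speed \<gamma> L * (vel R - vel L) \<le> dens L * vel L * (vel R - vel L)"
      using u by (intro mult_right_mono) auto
    then show ?thesis using rarefaction_1_pressure_drop[OF assms(1) V] u by linarith
  qed
  then show "vel L \<le> vel R" "pres R \<le> pres L"
    "pres L - pres R \<le> dens L * vel L * (vel R - vel L)"
    using assms(3) unfolding rarefaction_connected_def by force+
qed

section \<open>The three structures\<close>

theorem theorem3p2:
  fixes \<gamma> Q :: real and W :: "nat \<Rightarrow> state" and U :: "real \<Rightarrow> real \<Rightarrow> state"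
  assumes "1 < \<gamma>" and "\<gamma> \<le> 3" and "Q > 0"
    and "is_state (W 1)" and "vel (W 1) > 0"
    and "double_CRPs_solution \<gamma> Q W U"
  shows "(mach \<gamma> (W 4) < mach \<gamma> (W 5) \<and> mach \<gamma> (W 5) < 1 \<longrightarrow>
            (W 1 = W 4 \<or> shock_connected \<gamma> 1 (W 1) (W 4)) \<and> W 2 = W 4 \<and> W 3 = W 4 \<and>
            heating_discontinuity \<gamma> Q (W 4) (W 5) \<and>
            W 6 = W 5 \<and>
            (W 5 = W 7 \<or> contact_connected \<gamma> (W 5) (W 7)) \<and>
            (W 7 = W 8 \<or> shock_connected \<gamma> 3 (W 7) (W 8)))
       \<and> (mach \<gamma> (W 4) < mach \<gamma> (W 5) \<and> mach \<gamma> (W 5) = 1 \<longrightarrow>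
            (W 1 = W 4 \<or> shock_connected \<gamma> 1 (W 1) (W 4)) \<and> W 2 = W 4 \<and> W 3 = W 4 \<and>
            heating_discontinuity \<gamma> Q (W 4) (W 5) \<and>
            (W 5 = W 6 \<or> rarefaction_connected \<gamma> 1 (W 5) (W 6)) \<and>
            (W 6 = W 7 \<or> contact_connected \<gamma> (W 6) (W 7)) \<and>
            (W 7 = W 8 \<or> shock_connected \<gamma> 3 (W 7) (W 8)))
       \<and> (mach \<gamma> (W 4) > mach \<gamma> (W 5) \<and> mach \<gamma> (W 5) \<ge> 1 \<longrightarrow>
            W 2 = W 1 \<and> W 3 = W 1 \<and> W 4 = W 1 \<and>
            heating_discontinuity \<gamma> Q (W 1) (W 5) \<and>
            (W 5 = W 6 \<or> rarefaction_connected \<gamma> 1 (W 5) (W 6)) \<and>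
            (W 6 = W 7 \<or> contact_connected \<gamma> (W 6) (W 7)) \<and>
            (W 7 = W 8 \<or> shock_connected \<gamma> 3 (W 7) (W 8)))
       \<and> ((mach \<gamma> (W 4) < mach \<gamma> (W 5) \<and> mach \<gamma> (W 5) < 1) \<or>
          (mach \<gamma> (W 4) < mach \<gamma> (W 5) \<and> mach \<gamma> (W 5) = 1) \<or>
          (mach \<gamma> (W 4) > mach \<gamma> (W 5) \<and> mach \<gamma> (W 5) \<ge> 1))"
proof -
  note \<gamma> = assms(1) and u1 = assms(5)
  obtain V \<sigma>1 \<tau>1 \<sigma>2 \<sigma>3 \<tau>3 where left:
    "crp_solution \<gamma> V \<sigma>1 \<tau>1 \<sigma>2 \<sigma>3 \<tau>3 (W 1) (W 2) (W 3) (W 4)" "\<tau>3 \<le> 0"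
    using assms(6) unfolding double_CRPs_solution_def by blast
  have W8: "W 8 = W 1" and H: "heating_discontinuity \<gamma> Q (W 4) (W 5)" and "vel (W 4) \<noteq> 0"
    using assms(6) unfolding double_CRPs_solution_def by blast+
  obtain V' \<sigma>1' \<tau>1' \<sigma>2' \<sigma>3' \<tau>3' where right:
    "crp_solution \<gamma> V' \<sigma>1' \<tau>1' \<sigma>2' \<sigma>3' \<tau>3' (W 5) (W 6) (W 7) (W 1)" "0 \<le> \<sigma>1'"
    using assms(6) unfolding double_CRPs_solution_def W8 by metis
  have st: "is_state (W 1)" "is_state (W 4)" "is_state (W 5)" "is_state (W 6)" "is_state (W 7)"
    by (fact crp_solution_waves[OF left(1)] crp_solution_waves[OF right(1)])+
  have u4: "vel (W 4) > 0"
    using no_backflow[OF \<gamma> assms(3) u1 left right H] \<open>vel (W 4) \<noteq> 0\<close> by simp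
  have J: "heating_jump \<gamma> Q (W 4) (W 5)" using H by (simp add: heating_discontinuity_def)
  have u5: "vel (W 5) > 0" using heating_jump_vel_sign(1)[OF J st(2,3)] u4 by simp
  note heat = forward_heating[OF \<gamma> assms(3) st(2,3) H u4]
  note lf = left_fan_forward[OF \<gamma> left u4]
  define m where "m = dens (W 4) * vel (W 4)"
  have m: "m > 0" using st(2) u4 by (simp add: m_def is_state_def)
  have mass: "m = dens (W 5) * vel (W 5)" using J by (simp add: m_def heating_jump_def)
  have w1: "nonlinear_wave \<gamma> 1 V' \<sigma>1' \<tau>1' (W 5) (W 6)" and w2: "contact_wave \<gamma> V' \<sigma>2' (W 6) (W 7)"
    and w3: "nonlinear_wave \<gamma> 3 V' \<sigma>3' \<tau>3' (W 7) (W 1)"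
    by (fact crp_solution_waves[OF right(1)])+
  note c = contact_wave_continuity(1-3)[OF w2]
  note R3 = wave_3_comonotone[OF \<gamma> st(5,1) w3]
  have gap: "sonic_gap \<gamma> w < 0 \<longleftrightarrow> char_speed \<gamma> 1 w > 0" "sonic_gap \<gamma> w > 0 \<longleftrightarrow> char_speed \<gamma> 1 w < 0"
    if "is_state w" "vel w > 0" for w
    using that(2) unfolding sonic_gap_neg_iff[OF \<gamma> that(1)] sonic_gap_pos_iff[OF \<gamma> that(1)] char_speed_1
    by auto
  \<comment> \<open>A 1-wave on the left would be swept by the supersonic flow into the heating point.\<close>
  have supersonic: "W 4 = W 1" if "sonic_gap \<gamma> (W 4) < 0"
    using lf(3) gap[OF st(2) u4] that unfolding shock_def by auto
  have right1: "W 5 = W 6 \<or> (rarefaction_connected \<gamma> 1 (W 5) (W 6) \<and> 0 \<le> char_speed \<gamma> 1 (W 5))"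
  proof (rule ccontr)
    assume "\<not> ?thesis"
    then have sh: "shock \<gamma> 1 \<sigma>1' (W 5) (W 6)"
      using w1 right(2) unfolding nonlinear_wave_def rarefaction_connected_def by blast
    then have "char_speed \<gamma> 1 (W 5) > 0" using right(2) by (auto simp: shock_def)
    then have "sonic_gap \<gamma> (W 5) < 0" using gap(1)[OF st(3) u5] by simp
    then have s: "sonic_gap \<gamma> (W 4) < 0" "pres (W 4) < pres (W 5)" "vel (W 5) < vel (W 4)"
      using heat by auto
    \<comment> \<open>The last wave would accelerate the gas while lowering its pressure.\<close>
    show False
      using R3 c shock_1_monotone(1,2)[OF \<gamma> st(3,4) sh] s supersonic by auto
  qed
  note d = downstream_rarefaction_1_bound[OF \<gamma> st(3) right1]
  have left1: "W 1 = W 4 \<or> (\<exists>s\<le>0. shock \<gamma> 1 s (W 1) (W 4))"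
  proof (rule ccontr)
    assume "\<not> ?thesis"
    then obtain V where V: "rarefaction \<gamma> 1 V (W 1) (W 4)" and "char_speed \<gamma> 1 (W 4) \<le> 0"
      using lf(3) unfolding rarefaction_connected_def by blast
    then have "vel (W 1) < vel (W 4)" "pres (W 4) < pres (W 1)" "\<not> sonic_gap \<gamma> (W 4) < 0"
      using rarefaction_vel_increasing[OF \<gamma> _ V] rarefaction_1_pressure_drop(1)[OF \<gamma> V]
        gap(1)[OF st(2) u4] by linarith+
    \<comment> \<open>The last wave would slow the gas down while raising its pressure.\<close>
    then show False using R3 c d heat by auto
  qed
  have right3: "W 7 = W 8 \<or> shock_connected \<gamma> 3 (W 7) (W 8)"
  proof (rule ccontr)
    assume "\<not> ?thesis"
    then have less: "vel (W 6) < vel (W 1)" "pres (W 6) < pres (W 1)" using R3 c W8 by auto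
    \<comment> \<open>The pressure drop from the initial state is at most \<open>m\<close> times the velocity gain, link by link.\<close>
    have "pres (W 1) - pres (W 4) \<le> m * (vel (W 4) - vel (W 1))"
      using left1 shock_1_monotone(3)[OF \<gamma> st(1,2)] by (auto simp: m_def algebra_simps)
    moreover have "pres (W 4) - pres (W 5) = m * (vel (W 5) - vel (W 4))"
      using heating_jump_pressure_velocity[OF J] by (simp add: m_def)
    moreover have "pres (W 5) - pres (W 6) \<le> m * (vel (W 6) - vel (W 5))"
      using d(3) by (simp add: mass)
    ultimately have "pres (W 1) - pres (W 6) \<le> m * (vel (W 6) - vel (W 1))"
      by (simp add: algebra_simps)
    moreover have "m * (vel (W 6) - vel (W 1)) < 0" using m less(1) by (simp add: mult_pos_neg)
    ultimately show False using less(2) by linarith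
  qed
  have left1': "W 1 = W 4 \<or> shock_connected \<gamma> 1 (W 1) (W 4)"
    using left1 by (auto simp: shock_connected_def)
  have M: "mach \<gamma> w > 0" "mach \<gamma> w < 1 \<longleftrightarrow> sonic_gap \<gamma> w > 0" "mach \<gamma> w > 1 \<longleftrightarrow> sonic_gap \<gamma> w < 0"
    if "is_state w" "vel w > 0" for w
  proof -
    show "mach \<gamma> w > 0" using sound_speed_pos[OF \<gamma> that(1)] that(2) by (simp add: mach_def)
    then show "mach \<gamma> w < 1 \<longleftrightarrow> sonic_gap \<gamma> w > 0" "mach \<gamma> w > 1 \<longleftrightarrow> sonic_gap \<gamma> w < 0"
      using abs_mach_less_1_iff[OF \<gamma> that(1)] abs_mach_greater_1_iff[OF \<gamma> that(1)] by auto
  qed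
  note M4 = M[OF st(2) u4] and M5 = M[OF st(3) u5]
  have mm: "dens (W 4) * vel (W 4) = dens (W 5) * vel (W 5)" using mass by (simp add: m_def)
  have regime: "(mach \<gamma> (W 4) < mach \<gamma> (W 5) \<and> mach \<gamma> (W 5) \<le> 1) \<or>
      (mach \<gamma> (W 5) < mach \<gamma> (W 4) \<and> 1 \<le> mach \<gamma> (W 5) \<and> W 4 = W 1)"
    using heat
  proof
    assume *: "sonic_gap \<gamma> (W 4) > 0 \<and> sonic_gap \<gamma> (W 5) \<ge> 0 \<and> pres (W 5) < pres (W 4) \<and> vel (W 4) < vel (W 5)"
    then have "mach \<gamma> (W 4) < mach \<gamma> (W 5)"
      using mach_less_if_faster_and_lower_pressure[OF \<gamma> st(2,3) mm u4] by blast
    moreover have "mach \<gamma> (W 5) \<le> 1" using * M5(3) by linarith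
    ultimately show ?thesis by blast
  next
    assume *: "sonic_gap \<gamma> (W 4) < 0 \<and> sonic_gap \<gamma> (W 5) \<le> 0 \<and> pres (W 4) < pres (W 5) \<and> vel (W 5) < vel (W 4)"
    then have "mach \<gamma> (W 5) < mach \<gamma> (W 4)"
      using mach_less_if_faster_and_lower_pressure[OF \<gamma> st(3,2) mm[symmetric] u5] by blast
    moreover have "1 \<le> mach \<gamma> (W 5)" using * M5(2) by linarith
    ultimately show ?thesis using * supersonic by blast
  qed
  have subsonic: "W 6 = W 5" if "mach \<gamma> (W 5) < 1"
    using right1 that M5(2) gap(2)[OF st(3) u5] by auto
  have contact': "W 5 = W 7 \<or> contact_connected \<gamma> (W 5) (W 7)" if "mach \<gamma> (W 5) < 1"
    using c(3) subsonic[OF that] by auto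
  have fan: "W 5 = W 6 \<or> rarefaction_connected \<gamma> 1 (W 5) (W 6)" using right1 by blast
  have super: "W 2 = W 1" "W 3 = W 1" "W 4 = W 1" "heating_discontinuity \<gamma> Q (W 1) (W 5)"
    if "mach \<gamma> (W 5) < mach \<gamma> (W 4)"
  proof -
    show 41: "W 4 = W 1" using regime that by linarith
    show "W 2 = W 1" "W 3 = W 1" "heating_discontinuity \<gamma> Q (W 1) (W 5)"
      using lf(1,2) H unfolding 41 by blast+
  qed
  have types: "(mach \<gamma> (W 4) < mach \<gamma> (W 5) \<and> mach \<gamma> (W 5) < 1) \<or>
      (mach \<gamma> (W 4) < mach \<gamma> (W 5) \<and> mach \<gamma> (W 5) = 1) \<or>
      (mach \<gamma> (W 4) > mach \<gamma> (W 5) \<and> mach \<gamma> (W 5) \<ge> 1)"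
    using regime by linarith
  show ?thesis
    by (intro conjI impI types lf(1,2) left1' H fan subsonic contact' c(3) right3 super; blast)
qed

end
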